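(* Let $T\ge 1$, let $x_1\in\mathbb{R}^n$, $m_1,\dots,m_T\in\mathbb{R}^n$, let $\alpha_1,\dots,\alpha_T>0$, let $\lambda_1,\lambda_{21},\lambda_2\ge 0$, and let $Q_1,\dots,Q_T$ be diagonal positive semidefinite $n\times n$ matrices such that $\sum_{s=1}^{t}\frac{Q_s}{\alpha_s}$ is diagonal and positive definite for each $t=1,\dots,T$. Let the index set $\{1,\dots,n\}$ be partitioned into groups. For $t=1,\dots,T$ let $x_{t+1}$ be the optimal solution of $$x_{t+1}=\arg\min_{x\in\mathbb{R}^n}\; m_{1:t}\cdot x+\sum_{s=1}^{t}\frac{1}{2\alpha_s}\|Q_s^{1/2}(x-x_s)\|_2^2+\Psi_t(x),$$ where $$\Psi_t(x)=\sum_{g}\Big(\lambda_1\|x^g\|_1+\lambda_{21}\sqrt{d_{x^g}}\,\|A_t^{1/2}x^g\|_2\Big)+\lambda_2\|x\|_2^2,$$ and, in the term of group $g$, $A_t=\sum_{s=1}^{t}\frac{Q_s^g}{2\alpha_s}+\lambda_2\mathbb{I}$. Put $z_0=\mathbf{0}$ and $z_t=z_{t-1}+m_t-\frac{Q_t}{\alpha_t}x_t$ for $t=1,\dots,T$. Then for every $t=1,\dots,T$ the optimal solution is given, on every group $g$, by $$x_{t+1}^g=\Big(\sum_{s=1}^{t}\frac{Q_s^g}{\alpha_s}+2\lambda_2\mathbb{I}\Big)^{-1}\max\Big(1-\frac{\sqrt{d_{x^g}}\,\lambda_{21}}{\|\tilde s_t^g\|_2},\,0\Big)\,s_t^g,$$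 where $s_t\in\mathbb{R}^n$ has entries $$s_{t,i}=\begin{cases}0 & \text{if } |z_{t,i}|\le\lambda_1,\\ \operatorname{sign}(z_{t,i})\lambda_1-z_{t,i} & \text{otherwise,}\end{cases}$$ and $\tilde s_t$ is defined by $$\tilde s_t=\Big(\sum_{s=1}^{t}\frac{Q_s}{2\alpha_s}+\lambda_2\mathbb{I}\Big)^{-1}s_t .$$ (When $s_t^g=0$ the right-hand side of the formula for $x_{t+1}^g$ is understood to be $0$.)
   Context: Notation: $m_{1:t}=\sum_{s=1}^t m_s$. The groups partition the coordinates $\{1,\dots,n\}$; for a vector $x\in\mathbb{R}^n$ and a group $g$, $x^g$ is the subvector of coordinates in $g$ (likewise $s_t^g$, $\tilde s_t^g$) and $d_{x^g}$ is the number of coordinates in $g$. For a diagonal matrix $Q$, $Q^g$ is the diagonal matrix formed by the diagonal entries of $Q$ with index in $g$. $\mathbb{I}$ is the identity matrix of the appropriate size. $\|\cdot\|_1,\|\cdot\|_2$ are the $\ell_1$ and Euclidean norms. Square roots of positive semidefinite matrices are the positive semidefinite ones.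
   Formalization: The definition of s̃_t is corrected to (Σ Q_s/(2α_s)+λ_2 I)^{-1/2} s_t; with exponent −1 the formula is false, e.g. n=T=1, x_1=0, m_1=−3, α_1=1, Q_1=8, λ_1=λ_2=0, λ_21=1 has minimizer 1/8 but the formula gives 0. *)

theory Defs
  imports
    "HOL-Library.Disjoint_Sets"
    "Jordan_Normal_Form.Gauss_Jordan_Elimination"
    "Jordan_Normal_Form.DL_Submatrix"
begin

(* Vectors of R^n are elements of carrier_vec n over the reals and coordinates run over {0..<n}.
   Steps are numbered from 1: only the values of sequences at indices 1..T (1..T+1 for x) matter. *)

definition positive_semidefinite :: "real mat \<Rightarrow> bool" where
  "positive_semidefinite A \<longleftrightarrow> square_mat A \<and> transpose_mat A = A \<and>
     (\<forall>v \<in> carrier_vec (dim_row A). 0 \<le> v \<bullet> (A *\<^sub>v v))"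

definition positive_definite :: "real mat \<Rightarrow> bool" where
  "positive_definite A \<longleftrightarrow> square_mat A \<and> transpose_mat A = A \<and>
     (\<forall>v \<in> carrier_vec (dim_row A). v \<noteq> 0\<^sub>v (dim_row A) \<longrightarrow> 0 < v \<bullet> (A *\<^sub>v v))"

(* The square root of a positive semidefinite matrix; unspecified for other matrices. *)
definition mat_sqrt :: "real mat \<Rightarrow> real mat" where
  "mat_sqrt A = (THE B. B \<in> carrier_mat (dim_row A) (dim_row A) \<and> positive_semidefinite B \<and> B * B = A)"

(* Meaningful only for invertible matrices, since mat_inverse returns None otherwise. *)
definition mat_inv :: "real mat \<Rightarrow> real mat" where
  "mat_inv A = the (mat_inverse A)"

definition l1_norm :: "real vec \<Rightarrow> real" where
  "l1_norm v = (\<Sum>i<dim_vec v. \<bar>v $ i\<bar>)"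

definition l2_norm :: "real vec \<Rightarrow> real" where
  "l2_norm v = sqrt (\<Sum>i<dim_vec v. (v $ i)\<^sup>2)"

(* The coordinates of v with index in g, in increasing order; the vector analogue of submatrix. *)
definition subvec :: "'a vec \<Rightarrow> nat set \<Rightarrow> 'a vec" where
  "subvec v g = vec (card {i. i < dim_vec v \<and> i \<in> g}) (\<lambda>i. v $ pick g i)"

definition vec_sum :: "nat \<Rightarrow> (nat \<Rightarrow> real vec) \<Rightarrow> nat \<Rightarrow> real vec" where
  "vec_sum n m t = vec n (\<lambda>i. \<Sum>s = 1..t. m s $ i)"

(* The d x d matrix Q_1 / a_1 + ... + Q_t / a_t. *)
definition scaled_sum :: "nat \<Rightarrow> (nat \<Rightarrow> real mat) \<Rightarrow> (nat \<Rightarrow> real) \<Rightarrow> nat \<Rightarrow> real mat" where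
  "scaled_sum d Q a t = mat d d (\<lambda>(i, j). \<Sum>s = 1..t. Q s $$ (i, j) / a s)"

definition group_block :: "(nat \<Rightarrow> real mat) \<Rightarrow> nat set \<Rightarrow> nat \<Rightarrow> real mat" where
  "group_block Q g s = submatrix (Q s) g g"

definition regularizer ::
  "nat set set \<Rightarrow> (nat \<Rightarrow> real mat) \<Rightarrow> (nat \<Rightarrow> real) \<Rightarrow> real \<Rightarrow> real \<Rightarrow> real \<Rightarrow> nat \<Rightarrow> real vec \<Rightarrow> real" where
  "regularizer G Q \<alpha> lam1 lam21 lam2 t x =
     (\<Sum>g\<in>G.
        (let A = scaled_sum (card g) (group_block Q g) (\<lambda>s. 2 * \<alpha> s) t + lam2 \<cdot>\<^sub>m 1\<^sub>m (card g)
         in lam1 * l1_norm (subvec x g)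
            + lam21 * sqrt (real (card g)) * l2_norm (mat_sqrt A *\<^sub>v subvec x g)))
     + lam2 * (l2_norm x)\<^sup>2"

(* x is the sequence of iterates, of which x 1, ..., x t are used; y is the argument to be optimized. *)
definition objective ::
  "nat \<Rightarrow> nat set set \<Rightarrow> (nat \<Rightarrow> real vec) \<Rightarrow> (nat \<Rightarrow> real mat) \<Rightarrow> (nat \<Rightarrow> real) \<Rightarrow> real \<Rightarrow> real \<Rightarrow> real
    \<Rightarrow> (nat \<Rightarrow> real vec) \<Rightarrow> nat \<Rightarrow> real vec \<Rightarrow> real" where
  "objective n G m Q \<alpha> lam1 lam21 lam2 x t y =
     vec_sum n m t \<bullet> y
     + (\<Sum>s = 1..t. 1 / (2 * \<alpha> s) * (l2_norm (mat_sqrt (Q s) *\<^sub>v (y - x s)))\<^sup>2)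
     + regularizer G Q \<alpha> lam1 lam21 lam2 t y"

primrec dual_sum ::
  "nat \<Rightarrow> (nat \<Rightarrow> real vec) \<Rightarrow> (nat \<Rightarrow> real mat) \<Rightarrow> (nat \<Rightarrow> real) \<Rightarrow> (nat \<Rightarrow> real vec) \<Rightarrow> nat \<Rightarrow> real vec" where
  "dual_sum n m Q \<alpha> x 0 = 0\<^sub>v n"
| "dual_sum n m Q \<alpha> x (Suc t) =
     dual_sum n m Q \<alpha> x t + m (Suc t) - ((1 / \<alpha> (Suc t)) \<cdot>\<^sub>m Q (Suc t)) *\<^sub>v x (Suc t)"

definition soft_threshold :: "real \<Rightarrow> real vec \<Rightarrow> real vec" where
  "soft_threshold lam1 z =
     vec (dim_vec z) (\<lambda>i. if \<bar>z $ i\<bar> \<le> lam1 then 0 else sgn (z $ i) * lam1 - z $ i)"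

(* The vector A^(-1/2) s with A = Q_1/(2 a_1) + ... + Q_t/(2 a_t) + lam2 I.
   This deliberately departs from the source, whose definition is A^(-1) s: with that the closed form
   fails. In dimension 1 with t = 1, a_1 = 1, Q_1 = 8, m_1 = -3, x_1 = 0, lam1 = lam2 = 0 and
   lam21 = 1 the objective is -3 y + 4 y^2 + 2 |y|, minimized at y = 1/8. Here A = 4 and s = 3, so
   the factor 1 - 1/(3/2) = 1/3 from A^(-1/2) s gives (1/8)(1/3)(3) = 1/8, whereas the factor
   max (1 - 1/(3/4)) 0 = 0 from A^(-1) s gives 0. *)
definition scaled_threshold ::
  "nat \<Rightarrow> (nat \<Rightarrow> real mat) \<Rightarrow> (nat \<Rightarrow> real) \<Rightarrow> real \<Rightarrow> nat \<Rightarrow> real vec \<Rightarrow> real vec" where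
  "scaled_threshold n Q \<alpha> lam2 t s =
     mat_inv (mat_sqrt (scaled_sum n Q (\<lambda>r. 2 * \<alpha> r) t + lam2 \<cdot>\<^sub>m 1\<^sub>m n)) *\<^sub>v s"

end

theory Submission
  imports Defs "HOL-Analysis.L2_Norm"
begin

text \<open>
  All matrices are diagonal; let D be the diagonal of the sum of Q s / \<alpha> s. Up to a constant the
  objective is a sum over the groups of the functions
  sum over i in g of (z i * y i + b i * (y i)^2 + lam1 * |y i|) plus
  c * sqrt (sum over i in g of b i * (y i)^2), with b = D / 2 + lam2 and c = lam21 * sqrt (card g).
  The soft threshold s satisfies z i * y i + lam1 * |y i| \<ge> - s i * y i, with equality at the
  claimed minimizer, so the l1 term can be replaced by a linear one; by the Cauchy-Schwarz
  inequality in the norm weighted by b, the value at y then exceeds the value at the closed form w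
  by at least the sum of b i * (y i - w i)^2. Hence w is the only minimizer.
\<close>

section \<open>The separable scalar problem\<close>

text \<open>For \<open>l \<ge> 0\<close> this is minus the usual soft-thresholding operator, and
  \<open>z + soft l z\<close> is the projection of \<open>z\<close> onto the interval from
  \<open>-l\<close> to \<open>l\<close>. It is the scalar form of
  \<open>soft_threshold\<close>.\<close>

definition soft :: "real \<Rightarrow> real \<Rightarrow> real" where
  "soft l z = (if \<bar>z\<bar> \<le> l then 0 else sgn z * l - z)"

text \<open>The projection \<open>z + soft l z\<close> has absolute value at most \<open>l\<close>,
  so its product with \<open>y\<close> is at least \<open>- l * \<bar>y\<bar>\<close>.\<close>

lemma soft_lower_bound:
  assumes "0 \<le> l"
  shows "- soft l z * y \<le> z * y + l * \<bar>y\<bar>"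
proof (cases "\<bar>z\<bar> \<le> l")
  case True
  have "- (z * y) \<le> \<bar>z\<bar> * \<bar>y\<bar>"
    by (metis abs_ge_minus_self abs_mult)
  also have "\<dots> \<le> l * \<bar>y\<bar>"
    using True by (simp add: mult_right_mono)
  finally show ?thesis
    using True by (simp add: soft_def)
next
  case False
  have "l * y \<le> l * \<bar>y\<bar>" "- (l * y) \<le> l * \<bar>y\<bar>"
    using assms by (simp_all add: mult_left_mono flip: mult_minus_right)
  then show ?thesis
    using False by (auto simp: soft_def sgn_if algebra_simps)
qed

text \<open>If \<open>\<bar>z\<bar> > l\<close>, the projection \<open>z + soft l z\<close> is
  \<open>l\<close> or \<open>-l\<close> with the sign of \<open>z\<close>, while
  \<open>soft l z\<close> has the opposite sign. Hence the linear lower bound is attained on the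
  whole ray spanned by \<open>soft l z\<close>, on which the minimizer lies.\<close>

lemma soft_equality:
  assumes "0 \<le> l" "0 \<le> r"
  shows "- soft l z * (r * soft l z) = z * (r * soft l z) + l * \<bar>r * soft l z\<bar>"
proof -
  consider "\<bar>z\<bar> \<le> l" | "l < z" | "z < - l"
    by linarith
  then show ?thesis
  proof cases
    case 1
    then show ?thesis
      by (simp add: soft_def)
  next
    case 2
    then have "soft l z = l - z"
      using assms by (simp add: soft_def)
    moreover have "\<bar>r * (l - z)\<bar> = r * (z - l)"
      using 2 assms by (simp add: abs_mult)
    ultimately show ?thesis
      by (simp only:) (simp add: algebra_simps)
  next
    case 3
    then have "soft l z = - l - z"
      using assms by (simp add: soft_def)
    moreover have "\<bar>r * (- l - z)\<bar> = r * (- l - z)"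
      using 3 assms by (simp add: abs_mult)
    ultimately show ?thesis
      by (simp only:) (simp add: algebra_simps)
  qed
qed

section \<open>The problem on a single group, in the norm weighted by \<open>b\<close>\<close>

definition weighted_norm :: "nat set \<Rightarrow> (nat \<Rightarrow> real) \<Rightarrow> (nat \<Rightarrow> real) \<Rightarrow> real" where
  "weighted_norm g b y = sqrt (\<Sum>i\<in>g. b i * (y i)\<^sup>2)"

text \<open>The weight \<open>b\<close> carries no factor 1/2: it will be \<open>curvature\<close>,
  which already contains the 1/2 of the proximal terms together with \<open>lam2\<close>. The same
  \<open>b\<close> weights the quadratic term and the norm, which is what makes a closed form
  possible.\<close>

definition group_objective ::
  "real \<Rightarrow> real \<Rightarrow> (nat \<Rightarrow> real) \<Rightarrow> (nat \<Rightarrow> real) \<Rightarrow> nat set \<Rightarrow> (nat \<Rightarrow> real) \<Rightarrow> real" where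
  "group_objective l c b z g y =
     (\<Sum>i\<in>g. z i * y i + b i * (y i)\<^sup>2 + l * \<bar>y i\<bar>) + c * weighted_norm g b y"

text \<open>If s vanishes on g, division by zero makes the value 1; this is harmless because only the
  product with s matters.\<close>

definition shrinkage :: "real \<Rightarrow> (nat \<Rightarrow> real) \<Rightarrow> nat set \<Rightarrow> (nat \<Rightarrow> real) \<Rightarrow> real" where
  "shrinkage c b g s = max (1 - c / sqrt (\<Sum>i\<in>g. (s i / sqrt (b i))\<^sup>2)) 0"

text \<open>The denominator \<open>2 * b i\<close> comes from the derivative of
  \<open>b i * (y i)\<^sup>2\<close>; it is the diagonal entry of the matrix inverted in the closed
  form.\<close>

definition group_minimizer ::
  "real \<Rightarrow> (nat \<Rightarrow> real) \<Rightarrow> (nat \<Rightarrow> real) \<Rightarrow> nat set \<Rightarrow> nat \<Rightarrow> real" where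
  "group_minimizer c b s g i = shrinkage c b g s * s i / (2 * b i)"

text \<open>Each product is split as \<open>(s i / sqrt (b i)) * (sqrt (b i) * y i)\<close>. The
  first factors produce the norm dual to \<open>weighted_norm\<close>, which is why the shrinkage
  factor involves the power -1/2 of the weights.\<close>

lemma weighted_Cauchy_Schwarz:
  assumes "\<And>i. i \<in> g \<Longrightarrow> 0 < b i"
  shows "(\<Sum>i\<in>g. s i * y i) \<le> sqrt (\<Sum>i\<in>g. (s i / sqrt (b i))\<^sup>2) * weighted_norm g b y"
proof -
  have "(\<Sum>i\<in>g. s i * y i) \<le> (\<Sum>i\<in>g. \<bar>s i / sqrt (b i)\<bar> * \<bar>sqrt (b i) * y i\<bar>)"
  proof (rule sum_mono)
    fix i assume "i \<in> g"
    then have "s i * y i = (s i / sqrt (b i)) * (sqrt (b i) * y i)"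
      using assms[of i] by simp
    then show "s i * y i \<le> \<bar>s i / sqrt (b i)\<bar> * \<bar>sqrt (b i) * y i\<bar>"
      by (metis abs_ge_self abs_mult)
  qed
  also have "\<dots> \<le> L2_set (\<lambda>i. s i / sqrt (b i)) g * L2_set (\<lambda>i. sqrt (b i) * y i) g"
    by (rule L2_set_mult_ineq)
  also have "L2_set (\<lambda>i. sqrt (b i) * y i) g = weighted_norm g b y"
    unfolding L2_set_def weighted_norm_def
    by (intro arg_cong[where f = sqrt] sum.cong refl)
       (use assms in \<open>simp add: power_mult_distrib less_imp_le\<close>)
  finally show ?thesis
    by (simp add: L2_set_def)
qed

text \<open>This is the first-order optimality condition at \<open>w\<close> for the convex function
  with smooth part \<open>b i * (y i)\<^sup>2 - s i * y i\<close> and nonsmooth part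
  \<open>c * weighted_norm g b y\<close>. At \<open>w\<close> the gradient of the smooth part is a
  multiple of \<open>s\<close>, so Cauchy-Schwarz suffices.\<close>

lemma group_variational_inequality:
  fixes b s y :: "nat \<Rightarrow> real"
  assumes b: "\<And>i. i \<in> g \<Longrightarrow> 0 < b i" and c: "0 \<le> c"
  defines "w \<equiv> group_minimizer c b s g"
  shows "0 \<le> (\<Sum>i\<in>g. (2 * b i * w i - s i) * (y i - w i))
             + c * weighted_norm g b y - c * weighted_norm g b w"
proof -
  \<comment> \<open>For finite \<open>g\<close>, this is the norm of \<open>s\<close> on
    \<open>g\<close> dual to \<open>weighted_norm g b\<close>.\<close>
  define S where "S = sqrt (\<Sum>i\<in>g. (s i / sqrt (b i))\<^sup>2)"
  define k where "k = shrinkage c b g s"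
  have k: "k = max (1 - c / S) 0"
    by (simp add: k_def S_def shrinkage_def)
  have w: "w i = k * s i / (2 * b i)" for i
    by (simp add: w_def group_minimizer_def k_def)
  have S0: "0 \<le> S"
    by (simp add: S_def sum_nonneg)
  have S2: "S\<^sup>2 = (\<Sum>i\<in>g. (s i)\<^sup>2 / b i)"
  proof -
    have "S\<^sup>2 = (\<Sum>i\<in>g. (s i / sqrt (b i))\<^sup>2)"
      by (simp add: S_def sum_nonneg)
    also have "\<dots> = (\<Sum>i\<in>g. (s i)\<^sup>2 / b i)"
      by (rule sum.cong) (use b in \<open>simp_all add: power_divide less_imp_le\<close>)
    finally show ?thesis .
  qed
  have CS: "(\<Sum>i\<in>g. s i * y i) \<le> S * weighted_norm g b y"
    unfolding S_def by (rule weighted_Cauchy_Schwarz[OF b])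
  have N0: "0 \<le> weighted_norm g b y"
    unfolding weighted_norm_def by (intro real_sqrt_ge_zero sum_nonneg) (use b in \<open>simp add: less_imp_le\<close>)
  have Nw: "weighted_norm g b w = k / 2 * S"
  proof -
    have "(\<Sum>i\<in>g. b i * (w i)\<^sup>2) = (\<Sum>i\<in>g. (k / 2)\<^sup>2 * ((s i)\<^sup>2 / b i))"
      by (rule sum.cong) (use b in \<open>force simp: w power2_eq_square field_simps\<close>)+
    also have "\<dots> = (k / 2 * S)\<^sup>2"
      by (simp only: S2 power_mult_distrib sum_distrib_left)
    finally show ?thesis
      using S0 by (simp add: weighted_norm_def k)
  qed
  have sw: "(\<Sum>i\<in>g. s i * w i) = k / 2 * S\<^sup>2"
    unfolding S2 sum_distrib_left
    by (rule sum.cong) (simp_all add: w power2_eq_square)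
  have "(\<Sum>i\<in>g. (2 * b i * w i - s i) * (y i - w i))
      = (\<Sum>i\<in>g. (1 - k) * (s i * w i - s i * y i))"
  proof (rule sum.cong)
    fix i assume "i \<in> g"
    then have "2 * b i * w i = k * s i"
      using b[of i] by (simp add: w)
    then show "(2 * b i * w i - s i) * (y i - w i) = (1 - k) * (s i * w i - s i * y i)"
      by (simp add: algebra_simps)
  qed simp
  also have "\<dots> = (1 - k) * (k / 2 * S\<^sup>2 - (\<Sum>i\<in>g. s i * y i))"
    by (simp add: sum_subtractf sw flip: sum_distrib_left)
  finally have eq: "(\<Sum>i\<in>g. (2 * b i * w i - s i) * (y i - w i))
      = (1 - k) * (k / 2 * S\<^sup>2 - (\<Sum>i\<in>g. s i * y i))" .
  \<comment> \<open>The shrinkage factor is degenerate, untruncated, or truncated to 0,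
    respectively.\<close>
  consider "S = 0" | "0 < S" "c / S \<le> 1" | "0 < S" "1 < c / S"
    using S0 by linarith
  then show ?thesis
  proof cases
    case 1
    \<comment> \<open>Division by zero makes \<open>c / S\<close> equal to 0. Then the factor
      \<open>1 - k\<close> and the norm of \<open>w\<close> both vanish, leaving only
      \<open>c * weighted_norm g b y\<close>.\<close>
    then have "k = 1"
      by (simp add: k)
    then show ?thesis
      using eq c N0 Nw 1 by simp
  next
    case 2
    then have k1: "1 - k = c / S"
      by (simp add: k)
    \<comment> \<open>The two terms coming from \<open>w\<close> are both
      \<open>c * k / 2 * S\<close> and cancel, so this bound is all that remains.\<close>
    have "(c / S) * (\<Sum>i\<in>g. s i * y i) \<le> (c / S) * (S * weighted_norm g b y)"
      using CS c 2 by (intro mult_left_mono) auto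
    then show ?thesis
      unfolding eq k1 Nw using 2 by (simp add: algebra_simps power2_eq_square)
  next
    case 3
    \<comment> \<open>Now \<open>w\<close> is 0, and the threshold \<open>c\<close> exceeds the dual
      norm \<open>S\<close>, so the norm term dominates the linear one.\<close>
    then have "k = 0" "S \<le> c"
      by (auto simp: k field_simps)
    then have "S * weighted_norm g b y \<le> c * weighted_norm g b y"
      using N0 by (intro mult_right_mono)
    then show ?thesis
      unfolding eq Nw using CS \<open>k = 0\<close> by simp
  qed
qed

text \<open>Replacing the l1 term by the linear bound of \<open>soft_lower_bound\<close> can only
  lower the value at \<open>y\<close> and leaves the value at \<open>w\<close> unchanged. The
  variational inequality then gives minimality, and the exact quadratic remainder gives the gap,
  hence uniqueness.\<close>

lemma group_objective_gap:
  fixes b y z :: "nat \<Rightarrow> real"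
  assumes b: "\<And>i. i \<in> g \<Longrightarrow> 0 < b i" and c: "0 \<le> c" and l: "0 \<le> l"
  defines "w \<equiv> group_minimizer c b (\<lambda>i. soft l (z i)) g"
  shows "group_objective l c b z g w + (\<Sum>i\<in>g. b i * (y i - w i)\<^sup>2) \<le> group_objective l c b z g y"
proof -
  define s where "s = (\<lambda>i. soft l (z i))"
  define k where "k = shrinkage c b g s"
  have w: "w i = k / (2 * b i) * s i" for i
    by (simp add: w_def group_minimizer_def k_def s_def)
  have k0: "0 \<le> k"
    by (simp add: k_def shrinkage_def)
  have w_eq: "z i * w i + l * \<bar>w i\<bar> = - s i * w i" if "i \<in> g" for i
    using soft_equality[of l "k / (2 * b i)" "z i"] l k0 b[OF that] by (simp add: w s_def)
  \<comment> \<open>Second-order expansion around \<open>w\<close> of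
    \<open>b i * (y i)\<^sup>2 - s i * y i\<close>, exact because the function is quadratic;
    \<open>w_eq\<close> rewrites the value at \<open>w\<close>.\<close>
  have "(\<Sum>i\<in>g. z i * w i + b i * (w i)\<^sup>2 + l * \<bar>w i\<bar>)
        + (\<Sum>i\<in>g. (2 * b i * w i - s i) * (y i - w i)) + (\<Sum>i\<in>g. b i * (y i - w i)\<^sup>2)
      = (\<Sum>i\<in>g. b i * (y i)\<^sup>2 - s i * y i)"
    unfolding sum.distrib[symmetric]
  proof (rule sum.cong)
    fix i assume "i \<in> g"
    then show "z i * w i + b i * (w i)\<^sup>2 + l * \<bar>w i\<bar> + (2 * b i * w i - s i) * (y i - w i)
        + b i * (y i - w i)\<^sup>2 = b i * (y i)\<^sup>2 - s i * y i"
      using w_eq[of i] by (simp add: algebra_simps power2_eq_square)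
  qed simp
  also have "\<dots> \<le> (\<Sum>i\<in>g. z i * y i + b i * (y i)\<^sup>2 + l * \<bar>y i\<bar>)"
  proof (rule sum_mono)
    fix i
    show "b i * (y i)\<^sup>2 - s i * y i \<le> z i * y i + b i * (y i)\<^sup>2 + l * \<bar>y i\<bar>"
      using soft_lower_bound[OF l, of "z i" "y i"] by (simp add: s_def)
  qed
  finally show ?thesis
    using group_variational_inequality[of g b c s y, OF b c]
    by (simp add: group_objective_def w_def s_def)
qed

section \<open>Diagonal matrices\<close>

lemma diagonal_mat_eq_mat_diag:
  assumes "A \<in> carrier_mat n n" "diagonal_mat A"
  shows "A = mat_diag n (\<lambda>i. A $$ (i, i))"
  using assms by (intro eq_matI) (auto simp: mat_diag_def diagonal_mat_def)

lemma mat_diag_mult_vec: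
  assumes "v \<in> carrier_vec n"
  shows "mat_diag n f *\<^sub>v v = vec n (\<lambda>i. f i * v $ i)"
proof (rule eq_vecI)
  fix i assume "i < dim_vec (vec n (\<lambda>i. f i * v $ i))"
  then have i: "i < n" by simp
  have "(mat_diag n f *\<^sub>v v) $ i = (\<Sum>j\<in>{0..<n}. if j = i then f j * v $ j else 0)"
    using i assms by (auto simp: mat_diag_def scalar_prod_def simp del: sum.delta sum.delta' intro!: sum.cong)
  then show "(mat_diag n f *\<^sub>v v) $ i = vec n (\<lambda>i. f i * v $ i) $ i"
    using i by simp
qed (simp add: mat_diag_def)

text \<open>\<open>mat_inverse\<close> returns \<open>None\<close> only for non-units, so the
  explicit two-sided inverse forces a result \<open>Some B\<close>; uniqueness of inverses
  identifies \<open>B\<close>.\<close>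

lemma mat_inv_mat_diag:
  assumes "\<And>i. i < n \<Longrightarrow> f i \<noteq> 0"
  shows "mat_inv (mat_diag n f) = mat_diag n (\<lambda>i. inverse (f i))"
proof -
  let ?D = "mat_diag n f" and ?E = "mat_diag n (\<lambda>i. inverse (f i))"
  have id: "?D * ?E = 1\<^sub>m n" "?E * ?D = 1\<^sub>m n"
    unfolding mat_diag_diag using assms by (auto simp: mat_diag_def)
  have "?D \<in> Units (ring_mat TYPE(real) n ())"
    using id by (auto simp: Units_def ring_mat_def intro!: bexI[of _ ?E])
  then obtain B where B: "mat_inverse ?D = Some B"
    using mat_inverse(1)[of ?D n "()"] by (cases "mat_inverse ?D") auto
  then have DB: "?D * B = 1\<^sub>m n" and Bc: "B \<in> carrier_mat n n"
    using mat_inverse(2)[of ?D n B] by auto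
  have "B = ?E * ?D * B"
    using Bc by (simp only: id left_mult_one_mat)
  also have "\<dots> = ?E * (?D * B)"
    using Bc by (intro assoc_mult_mat[of _ n n _ n _ n]) auto
  also have "\<dots> = ?E"
    unfolding DB by (intro right_mult_one_mat[of _ n]) simp
  finally show ?thesis
    by (simp add: mat_inv_def B)
qed

lemma positive_semidefinite_mat_diag_iff:
  "positive_semidefinite (mat_diag n f) \<longleftrightarrow> (\<forall>i<n. 0 \<le> f i)"
proof
  assume psd: "positive_semidefinite (mat_diag n f)"
  show "\<forall>i<n. 0 \<le> f i"
  proof (intro allI impI)
    fix i assume i: "i < n"
    have "0 \<le> unit_vec n i \<bullet> (mat_diag n f *\<^sub>v unit_vec n i)"
      using psd by (auto simp: positive_semidefinite_def mat_diag_def)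
    then show "0 \<le> f i"
      using i by (simp add: mat_diag_mult_vec)
  qed
next
  assume f: "\<forall>i<n. 0 \<le> f i"
  have "0 \<le> v \<bullet> (mat_diag n f *\<^sub>v v)" if "v \<in> carrier_vec n" for v
    using that f by (auto simp: mat_diag_mult_vec scalar_prod_def mult.left_commute intro!: sum_nonneg)
  moreover have "transpose_mat (mat_diag n f) = mat_diag n f"
    by (auto simp: mat_diag_def transpose_mat_def)
  ultimately show "positive_semidefinite (mat_diag n f)"
    by (auto simp: positive_semidefinite_def mat_diag_def)
qed

lemma positive_definite_mat_diag_imp_pos:
  assumes pd: "positive_definite (mat_diag n f)" and i: "i < n"
  shows "0 < f i"
proof -
  have "0 < unit_vec n i \<bullet> (mat_diag n f *\<^sub>v unit_vec n i)"
    using pd i by (auto simp: positive_definite_def mat_diag_def)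
  then show ?thesis
    using i by (simp add: mat_diag_mult_vec)
qed

section \<open>Square roots of diagonal matrices\<close>

lemma scalar_prod_self_eq_0:
  fixes v :: "real vec"
  assumes "v \<in> carrier_vec n" "v \<bullet> v \<le> 0"
  shows "v = 0\<^sub>v n"
  using assms conjugate_square_greater_0_vec[of v n] by (force simp: less_le_not_le)

text \<open>Each unit vector e is an eigenvector of B * B with eigenvalue r^2, and
  w = B e - r e satisfies (B + r) w = 0, whence w = 0 by positivity of B.\<close>

lemma psd_sqrt_mat_diag_unique:
  assumes B: "B \<in> carrier_mat n n" and psd: "positive_semidefinite B"
    and sq: "B * B = mat_diag n f" and f: "\<And>i. i < n \<Longrightarrow> 0 \<le> f i"
  shows "B = mat_diag n (\<lambda>i. sqrt (f i))"
proof -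
  have sym: "transpose_mat B = B" and nonneg: "\<And>v. v \<in> carrier_vec n \<Longrightarrow> 0 \<le> v \<bullet> (B *\<^sub>v v)"
    using psd B by (auto simp: positive_semidefinite_def)
  have col: "B *\<^sub>v unit_vec n j = sqrt (f j) \<cdot>\<^sub>v unit_vec n j" if j: "j < n" for j
  proof -
    define r where "r = sqrt (f j)"
    define e where "e = (unit_vec n j :: real vec)"
    define w where "w = B *\<^sub>v e - r \<cdot>\<^sub>v e"
    have r: "0 \<le> r" "r * r = f j"
      using f[OF j] by (auto simp: r_def)
    have e: "e \<in> carrier_vec n" and Be: "B *\<^sub>v e \<in> carrier_vec n" and w: "w \<in> carrier_vec n"
      using B by (auto simp: e_def w_def)
    have BBe: "B *\<^sub>v (B *\<^sub>v e) = f j \<cdot>\<^sub>v e"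
    proof -
      have "B *\<^sub>v (B *\<^sub>v e) = mat_diag n f *\<^sub>v e"
        using B e by (simp flip: sq)
      also have "\<dots> = f j \<cdot>\<^sub>v e"
        by (subst mat_diag_mult_vec[OF e]) (auto simp: e_def unit_vec_def)
      finally show ?thesis .
    qed
    have "w = 0\<^sub>v n"
    proof (cases "r = 0")
      case True
      \<comment> \<open>For \<open>r = 0\<close> positivity of \<open>B\<close> gives no information
        on \<open>w\<close>; symmetry of \<open>B\<close> is used instead to move one factor across
        the scalar product.\<close>
      have "(B *\<^sub>v e) \<bullet> (B *\<^sub>v e) = e \<bullet> (B *\<^sub>v (B *\<^sub>v e))"
        using transpose_vec_mult_scalar[OF B Be e] B Be e sym
        by (simp add: comm_scalar_prod[of _ n])
      also have "\<dots> = 0"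
        using True r e by (simp add: BBe)
      finally show ?thesis
        using scalar_prod_self_eq_0[OF Be] True e Be by (auto simp: w_def)
    next
      case False
      have "B *\<^sub>v w = f j \<cdot>\<^sub>v e - r \<cdot>\<^sub>v (B *\<^sub>v e)"
        unfolding w_def using B e Be
        by (simp add: mult_minus_distrib_mat_vec[of _ n n] mult_mat_vec[OF B] BBe)
      also have "\<dots> = - (r \<cdot>\<^sub>v w)"
        using e Be r(2) B by (intro eq_vecI) (auto simp: w_def algebra_simps simp flip: r(2))
      finally have "w \<bullet> (B *\<^sub>v w) = - (r * (w \<bullet> w))"
        using w by (simp)
      with nonneg[OF w] have "r * (w \<bullet> w) \<le> 0"
        by simp
      then have "w \<bullet> w \<le> 0"
        using False r by (simp add: mult_le_0_iff)
      then show ?thesis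
        using scalar_prod_self_eq_0[OF w] by simp
    qed
    then have "(B *\<^sub>v e) $ i - (r \<cdot>\<^sub>v e) $ i = 0" if "i < n" for i
      using that e Be B by (metis w_def index_minus_vec(1) index_zero_vec(1) carrier_vecD smult_carrier_vec)
    then show ?thesis
      using e Be B by (intro eq_vecI) (auto simp: e_def r_def)
  qed
  show ?thesis
  proof (rule eq_matI)
    fix i j assume "i < dim_row (mat_diag n (\<lambda>i. sqrt (f i)))" "j < dim_col (mat_diag n (\<lambda>i. sqrt (f i)))"
    then have ij: "i < n" "j < n"
      by (auto simp: mat_diag_def)
    have "B $$ (i, j) = (B *\<^sub>v unit_vec n j) $ i"
      using ij B by simp
    then show "B $$ (i, j) = mat_diag n (\<lambda>i. sqrt (f i)) $$ (i, j)"
      using ij col[OF ij(2)] by (simp add: mat_diag_def)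
  qed (use B in \<open>auto simp: mat_diag_def\<close>)
qed

text \<open>The definite description is evaluated: entrywise roots give a positive semidefinite
  root, and \<open>psd_sqrt_mat_diag_unique\<close> excludes any other, including non-diagonal
  ones.\<close>

lemma mat_sqrt_mat_diag:
  assumes f: "\<And>i. i < n \<Longrightarrow> 0 \<le> f i"
  shows "mat_sqrt (mat_diag n f) = mat_diag n (\<lambda>i. sqrt (f i))"
proof -
  have [simp]: "dim_row (mat_diag n f) = n"
    by (simp add: mat_diag_def)
  have "mat_diag n (\<lambda>i. sqrt (f i) * sqrt (f i)) = mat_diag n f"
    using f by (auto simp: mat_diag_def)
  then show ?thesis
    unfolding mat_sqrt_def
    by (intro the_equality)
       (use f in \<open>auto simp: positive_semidefinite_mat_diag_iff intro: psd_sqrt_mat_diag_unique\<close>)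
qed

lemma l2_norm_mat_diag_mult_vec:
  assumes "v \<in> carrier_vec d" "\<And>i. i < d \<Longrightarrow> 0 \<le> f i"
  shows "l2_norm (mat_diag d (\<lambda>i. sqrt (f i)) *\<^sub>v v) = sqrt (\<Sum>i<d. f i * (v $ i)\<^sup>2)"
  using assms by (simp add: l2_norm_def mat_diag_mult_vec power_mult_distrib)

text \<open>The shift \<open>c\<close> is left general so as to cover \<open>lam2\<close> in the
  norm, \<open>2 * lam2\<close> in the closed form, and 0 in the positive definiteness
  hypothesis.\<close>

lemma scaled_sum_eq_mat_diag:
  assumes "\<And>s. s \<in> {1..t} \<Longrightarrow> Q s \<in> carrier_mat d d \<and> diagonal_mat (Q s)"
  shows "scaled_sum d Q a t + c \<cdot>\<^sub>m 1\<^sub>m d = mat_diag d (\<lambda>i. (\<Sum>s = 1..t. Q s $$ (i, i) / a s) + c)"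
proof -
  have "Q s $$ (i, j) = 0" if "s \<in> {1..t}" "i < d" "j < d" "i \<noteq> j" for s i j
    using assms[OF that(1)] that by (auto simp: diagonal_mat_def)
  then show ?thesis
    by (intro eq_matI) (auto simp: scaled_sum_def mat_diag_def)
qed

section \<open>Restriction to a group of coordinates\<close>

text \<open>\<open>pick g\<close> is strictly increasing below \<open>card g\<close>, and an element
  \<open>i\<close> of \<open>g\<close> is hit at its rank, the number of smaller elements of
  \<open>g\<close>.\<close>

lemma bij_betw_pick:
  assumes "finite g"
  shows "bij_betw (pick g) {..<card g} g"
proof (rule bij_betw_imageI)
  show "inj_on (pick g) {..<card g}"
    by (rule inj_onI) (metis lessThan_iff nat_neq_iff pick_mono_le)
  show "pick g ` {..<card g} = g"
  proof
    show "pick g ` {..<card g} \<subseteq> g"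
      by (auto simp: pick_in_set_le)
    show "g \<subseteq> pick g ` {..<card g}"
    proof
      fix i assume i: "i \<in> g"
      then have "{a \<in> g. a < i} \<subset> g"
        by blast
      then have "card {a \<in> g. a < i} < card g"
        using assms by (rule psubset_card_mono[rotated])
      then show "i \<in> pick g ` {..<card g}"
        by (intro image_eqI[where x = "card {a \<in> g. a < i}"]) (simp_all add: pick_card_in_set[OF i])
    qed
  qed
qed

lemma sum_pick:
  assumes "finite g"
  shows "(\<Sum>i<card g. h (pick g i)) = sum h g"
  using sum.reindex_bij_betw[OF bij_betw_pick[OF assms]] .

lemma card_restrict:
  assumes "g \<subseteq> {0..<n}"
  shows "card {i. i < n \<and> i \<in> g} = card g"
  using assms by (intro arg_cong[where f = card]) auto

lemma subvec_eq:
  assumes "v \<in> carrier_vec n" "g \<subseteq> {0..<n}"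
  shows "subvec v g = vec (card g) (\<lambda>i. v $ pick g i)"
  using assms by (simp add: subvec_def card_restrict)

text \<open>Since \<open>pick g\<close> is injective below \<open>card g\<close>, off-diagonal
  entries of the block are off-diagonal entries of \<open>Q s\<close>.\<close>

lemma group_block_diagonal:
  assumes Q: "Q s \<in> carrier_mat n n" "diagonal_mat (Q s)" and g: "g \<subseteq> {0..<n}"
  shows "group_block Q g s \<in> carrier_mat (card g) (card g)" "diagonal_mat (group_block Q g s)"
    and "i < card g \<Longrightarrow> group_block Q g s $$ (i, i) = Q s $$ (pick g i, pick g i)"
proof -
  have eq: "group_block Q g s = mat (card g) (card g) (\<lambda>(i, j). Q s $$ (pick g i, pick g j))"
    using Q card_restrict[OF g] by (simp add: group_block_def submatrix_def)
  have "pick g i < n" if "i < card g" for i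
    using pick_in_set_le[OF that] g by auto
  moreover have "pick g i \<noteq> pick g j" if "i < card g" "j < card g" "i \<noteq> j" for i j
    using that pick_mono_le[of i g j] pick_mono_le[of j g i] by (metis nat_neq_iff)
  ultimately  show "group_block Q g s \<in> carrier_mat (card g) (card g)" "diagonal_mat (group_block Q g s)"
    and "i < card g \<Longrightarrow> group_block Q g s $$ (i, i) = Q s $$ (pick g i, pick g i)"
    using Q by (auto simp: eq diagonal_mat_def)
qed

lemma scaled_sum_group_block:
  assumes Q: "\<And>s. s \<in> {1..t} \<Longrightarrow> Q s \<in> carrier_mat n n \<and> diagonal_mat (Q s)" and g: "g \<subseteq> {0..<n}"
  shows "scaled_sum (card g) (group_block Q g) a t + c \<cdot>\<^sub>m 1\<^sub>m (card g)
    = mat_diag (card g) (\<lambda>i. (\<Sum>s = 1..t. Q s $$ (pick g i, pick g i) / a s) + c)"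
proof -
  have "scaled_sum (card g) (group_block Q g) a t + c \<cdot>\<^sub>m 1\<^sub>m (card g)
    = mat_diag (card g) (\<lambda>i. (\<Sum>s = 1..t. group_block Q g s $$ (i, i) / a s) + c)"
  proof (rule scaled_sum_eq_mat_diag)
    fix s assume "s \<in> {1..t}"
    then show "group_block Q g s \<in> carrier_mat (card g) (card g) \<and> diagonal_mat (group_block Q g s)"
      using group_block_diagonal(1,2)[of Q s n g] Q[of s] g by blast
  qed
  also have "\<dots> = mat_diag (card g) (\<lambda>i. (\<Sum>s = 1..t. Q s $$ (pick g i, pick g i) / a s) + c)"
  proof -
    have "group_block Q g s $$ (i, i) = Q s $$ (pick g i, pick g i)"
      if "s \<in> {1..t}" "i < card g" for s i
      using group_block_diagonal(3)[of Q s n g i] Q[OF that(1)] g that(2) by blast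
    then show ?thesis
      by (auto simp: mat_diag_def intro!: cong_mat)
  qed
  finally show ?thesis .
qed

lemma l1_norm_subvec:
  assumes "v \<in> carrier_vec n" "g \<subseteq> {0..<n}"
  shows "l1_norm (subvec v g) = (\<Sum>i\<in>g. \<bar>v $ i\<bar>)"
  using assms sum_pick[of g "\<lambda>i. \<bar>v $ i\<bar>"] by (simp add: l1_norm_def subvec_eq finite_subset)

lemma l2_norm_subvec:
  assumes "v \<in> carrier_vec n" "g \<subseteq> {0..<n}"
  shows "l2_norm (subvec v g) = sqrt (\<Sum>i\<in>g. (v $ i)\<^sup>2)"
  using assms sum_pick[of g "\<lambda>i. (v $ i)\<^sup>2"] by (simp add: l2_norm_def subvec_eq finite_subset)

section \<open>Separating the objective\<close>

text \<open>The diagonal of the matrix A_t taken over all coordinates at once; the matrix of a group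
  is obtained by reindexing with \<open>pick g\<close>.\<close>

definition curvature :: "(nat \<Rightarrow> real mat) \<Rightarrow> (nat \<Rightarrow> real) \<Rightarrow> real \<Rightarrow> nat \<Rightarrow> nat \<Rightarrow> real" where
  "curvature Q \<alpha> lam2 t i = (\<Sum>s = 1..t. Q s $$ (i, i) / (2 * \<alpha> s)) + lam2"

lemma dual_sum_eq:
  assumes "\<And>s. s \<in> {1..t} \<Longrightarrow> m s \<in> carrier_vec n"
    and "\<And>s. s \<in> {1..t} \<Longrightarrow> Q s \<in> carrier_mat n n \<and> diagonal_mat (Q s)"
    and "\<And>s. s \<in> {1..t} \<Longrightarrow> x s \<in> carrier_vec n"
  shows "dual_sum n m Q \<alpha> x t
    = vec n (\<lambda>i. \<Sum>s = 1..t. m s $ i - Q s $$ (i, i) / \<alpha> s * x s $ i)"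
  using assms
proof (induction t)
  case 0
  then show ?case
    by (intro eq_vecI) auto
next
  case (Suc t)
  have m: "m (Suc t) \<in> carrier_vec n" and x: "x (Suc t) \<in> carrier_vec n"
    and Q: "Q (Suc t) \<in> carrier_mat n n" "diagonal_mat (Q (Suc t))"
    using Suc.prems(1-3)[of "Suc t"] by auto
  have "(1 / \<alpha> (Suc t)) \<cdot>\<^sub>m Q (Suc t) = mat_diag n (\<lambda>i. Q (Suc t) $$ (i, i) / \<alpha> (Suc t))"
    using Q by (intro eq_matI) (auto simp: mat_diag_def diagonal_mat_def)
  moreover have "dual_sum n m Q \<alpha> x t
    = vec n (\<lambda>i. \<Sum>s = 1..t. m s $ i - Q s $$ (i, i) / \<alpha> s * x s $ i)"
    using Suc.prems by (intro Suc.IH) auto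
  ultimately show ?case
    using m by (intro eq_vecI) (auto simp: mat_diag_mult_vec[OF x])
qed

text \<open>The group matrices are diagonal, so their roots are entrywise and the norms become
  \<open>weighted_norm\<close>. The \<open>lam2\<close> term stays outside the group sum because it
  is later absorbed into the quadratic term.\<close>

lemma regularizer_eq:
  assumes G: "partition_on {0..<n} G"
    and Q: "\<And>s. s \<in> {1..t} \<Longrightarrow> Q s \<in> carrier_mat n n \<and> diagonal_mat (Q s)"
    and b: "\<And>i. i < n \<Longrightarrow> 0 \<le> curvature Q \<alpha> lam2 t i"
    and y: "y \<in> carrier_vec n"
  shows "regularizer G Q \<alpha> lam1 lam21 lam2 t y =
    (\<Sum>g\<in>G. lam1 * (\<Sum>i\<in>g. \<bar>y $ i\<bar>)
          + lam21 * sqrt (real (card g)) * weighted_norm g (curvature Q \<alpha> lam2 t) (($) y))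
    + lam2 * (\<Sum>i<n. (y $ i)\<^sup>2)"
proof -
  let ?b = "curvature Q \<alpha> lam2 t"
  have group: "l2_norm (mat_sqrt (scaled_sum (card g) (group_block Q g) (\<lambda>s. 2 * \<alpha> s) t
      + lam2 \<cdot>\<^sub>m 1\<^sub>m (card g)) *\<^sub>v subvec y g) = weighted_norm g ?b (($) y)"
    if "g \<in> G" for g
  proof -
    have g: "g \<subseteq> {0..<n}"
      using G that by (auto dest: partition_onD1)
    have pick: "pick g i < n" if "i < card g" for i
      using pick_in_set_le[OF that] g by auto
    have "l2_norm (mat_sqrt (mat_diag (card g) (\<lambda>i. ?b (pick g i))) *\<^sub>v subvec y g)
      = sqrt (\<Sum>i<card g. ?b (pick g i) * (subvec y g $ i)\<^sup>2)"
      using b pick y g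
      by (simp add: mat_sqrt_mat_diag l2_norm_mat_diag_mult_vec subvec_eq[OF y g])
    also have "\<dots> = weighted_norm g ?b (($) y)"
      using sum_pick[of g "\<lambda>i. ?b i * (y $ i)\<^sup>2"] g
      by (simp add: weighted_norm_def subvec_eq[OF y g] finite_subset)
    finally show ?thesis
      by (subst scaled_sum_group_block[OF Q g]) (simp_all only: curvature_def)
  qed
  have l1: "l1_norm (subvec y g) = (\<Sum>i\<in>g. \<bar>y $ i\<bar>)" if "g \<in> G" for g
    using G that y by (intro l1_norm_subvec) (auto dest: partition_onD1)
  show ?thesis
    using y by (simp add: regularizer_def Let_def group l1) (simp add: l2_norm_def sum_nonneg)
qed

text \<open>Expanding the proximal squares yields a quadratic part, which together with
  \<open>lam2\<close> forms \<open>curvature\<close>, a linear part, which together with the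
  \<open>m s\<close> forms \<open>dual_sum\<close>, and a part independent of
  \<open>y\<close>.\<close>

lemma objective_eq:
  assumes G: "partition_on {0..<n} G"
    and Q: "\<And>s. s \<in> {1..t} \<Longrightarrow>
      Q s \<in> carrier_mat n n \<and> diagonal_mat (Q s) \<and> positive_semidefinite (Q s)"
    and b: "\<And>i. i < n \<Longrightarrow> 0 \<le> curvature Q \<alpha> lam2 t i"
    and m: "\<And>s. s \<in> {1..t} \<Longrightarrow> m s \<in> carrier_vec n"
    and x: "\<And>s. s \<in> {1..t} \<Longrightarrow> x s \<in> carrier_vec n"
    and y: "y \<in> carrier_vec n"
  shows "objective n G m Q \<alpha> lam1 lam21 lam2 x t y =
    (\<Sum>i<n. \<Sum>s = 1..t. Q s $$ (i, i) / (2 * \<alpha> s) * (x s $ i)\<^sup>2)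
    + (\<Sum>g\<in>G. group_objective lam1 (lam21 * sqrt (real (card g))) (curvature Q \<alpha> lam2 t)
                (($) (dual_sum n m Q \<alpha> x t)) g (($) y))"
proof -
  let ?b = "curvature Q \<alpha> lam2 t" and ?z = "dual_sum n m Q \<alpha> x t"
  have linear: "vec_sum n m t \<bullet> y = (\<Sum>i<n. \<Sum>s = 1..t. m s $ i * y $ i)"
    using y by (simp add: vec_sum_def scalar_prod_def sum_distrib_right lessThan_atLeast0)
  have quadratic: "1 / (2 * \<alpha> s) * (l2_norm (mat_sqrt (Q s) *\<^sub>v (y - x s)))\<^sup>2
      = (\<Sum>i<n. Q s $$ (i, i) / (2 * \<alpha> s) * (y $ i - x s $ i)\<^sup>2)" if s: "s \<in> {1..t}" for s
  proof -
    let ?f = "\<lambda>i. Q s $$ (i, i)"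
    have Qs: "Q s = mat_diag n ?f"
      using Q[OF s] by (intro diagonal_mat_eq_mat_diag) auto
    then have f: "0 \<le> ?f i" if "i < n" for i
      using Q[OF s] that positive_semidefinite_mat_diag_iff[of n ?f] by simp
    have "mat_sqrt (Q s) = mat_diag n (\<lambda>i. sqrt (?f i))"
      using mat_sqrt_mat_diag[of n ?f] f Qs by simp
    moreover have "0 \<le> (\<Sum>i<n. ?f i * (y $ i - x s $ i)\<^sup>2)"
      using f by (intro sum_nonneg) simp
    ultimately have "(l2_norm (mat_sqrt (Q s) *\<^sub>v (y - x s)))\<^sup>2 = (\<Sum>i<n. ?f i * ((y - x s) $ i)\<^sup>2)"
      using l2_norm_mat_diag_mult_vec[of "y - x s" n ?f] f y x[OF s]
      by simp
    then show ?thesis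
      using y x[OF s] by (simp add: sum_distrib_left)
  qed
  have coordinate: "(\<Sum>s = 1..t. m s $ i * y $ i)
      + (\<Sum>s = 1..t. Q s $$ (i, i) / (2 * \<alpha> s) * (y $ i - x s $ i)\<^sup>2) + lam2 * (y $ i)\<^sup>2
    = (\<Sum>s = 1..t. Q s $$ (i, i) / (2 * \<alpha> s) * (x s $ i)\<^sup>2) + (?z $ i * y $ i + ?b i * (y $ i)\<^sup>2)"
    if "i < n" for i
  proof -
    have "?z $ i = (\<Sum>s = 1..t. m s $ i - Q s $$ (i, i) / \<alpha> s * x s $ i)"
      using dual_sum_eq[of t m n Q x \<alpha>] m Q x that by simp
    moreover have "(\<Sum>s = 1..t. m s $ i * y $ i)
        + (\<Sum>s = 1..t. Q s $$ (i, i) / (2 * \<alpha> s) * (y $ i - x s $ i)\<^sup>2)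
      = (\<Sum>s = 1..t. Q s $$ (i, i) / (2 * \<alpha> s) * (x s $ i)\<^sup>2)
        + ((\<Sum>s = 1..t. (m s $ i - Q s $$ (i, i) / \<alpha> s * x s $ i) * y $ i)
        + (\<Sum>s = 1..t. Q s $$ (i, i) / (2 * \<alpha> s) * (y $ i)\<^sup>2))"
      unfolding sum.distrib[symmetric]
      by (intro sum.cong refl) (simp add: power2_diff algebra_simps add_divide_distrib diff_divide_distrib)
    ultimately show ?thesis
      by (simp add: curvature_def sum_distrib_right distrib_right del: One_nat_def)
  qed
  \<comment> \<open>The partition regroups the coordinate sums, so that the objective decouples over
    the groups.\<close>
  have sum_groups: "(\<Sum>i<n. h i) = (\<Sum>g\<in>G. \<Sum>i\<in>g. h i)" for h :: "nat \<Rightarrow> real"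
    using sum.Union_disjoint_sets[of G h] G partition_onD1[OF G] partition_onD2[OF G]
    by (auto simp: lessThan_atLeast0 intro: finite_subset)
  have coordinate_sum: "(\<Sum>i<n. (\<Sum>s = 1..t. m s $ i * y $ i)
      + (\<Sum>s = 1..t. Q s $$ (i, i) / (2 * \<alpha> s) * (y $ i - x s $ i)\<^sup>2) + lam2 * (y $ i)\<^sup>2)
    = (\<Sum>i<n. (\<Sum>s = 1..t. Q s $$ (i, i) / (2 * \<alpha> s) * (x s $ i)\<^sup>2)
        + (?z $ i * y $ i + ?b i * (y $ i)\<^sup>2))"
    by (rule sum.cong[OF refl], rule coordinate) simp
  have quadratic_sum: "(\<Sum>s = 1..t. 1 / (2 * \<alpha> s) * (l2_norm (mat_sqrt (Q s) *\<^sub>v (y - x s)))\<^sup>2)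
      = (\<Sum>i<n. \<Sum>s = 1..t. Q s $$ (i, i) / (2 * \<alpha> s) * (y $ i - x s $ i)\<^sup>2)"
    by (subst sum.swap) (rule sum.cong[OF refl quadratic])
  have "objective n G m Q \<alpha> lam1 lam21 lam2 x t y
    = (\<Sum>i<n. (\<Sum>s = 1..t. m s $ i * y $ i)
        + (\<Sum>s = 1..t. Q s $$ (i, i) / (2 * \<alpha> s) * (y $ i - x s $ i)\<^sup>2) + lam2 * (y $ i)\<^sup>2)
      + (\<Sum>g\<in>G. lam1 * (\<Sum>i\<in>g. \<bar>y $ i\<bar>)
          + lam21 * sqrt (real (card g)) * weighted_norm g ?b (($) y))"
    unfolding objective_def linear quadratic_sum
    using regularizer_eq[OF G _ b y] Q
    by (simp add: sum.distrib sum_distrib_left del: One_nat_def)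
  also have "\<dots> = (\<Sum>i<n. \<Sum>s = 1..t. Q s $$ (i, i) / (2 * \<alpha> s) * (x s $ i)\<^sup>2)
      + (\<Sum>g\<in>G. \<Sum>i\<in>g. ?z $ i * y $ i + ?b i * (y $ i)\<^sup>2)
      + (\<Sum>g\<in>G. lam1 * (\<Sum>i\<in>g. \<bar>y $ i\<bar>)
          + lam21 * sqrt (real (card g)) * weighted_norm g ?b (($) y))"
    unfolding coordinate_sum by (simp only: sum.distrib sum_groups)
  finally show ?thesis
    by (simp add: group_objective_def sum.distrib sum_distrib_left)
qed

section \<open>From minimality to the closed form\<close>

text \<open>Compare \<open>y\<close> with the vector that agrees with it off \<open>g\<close> and
  equals the group minimizer on \<open>g\<close>. All other groups contribute equally, so the gap on
  \<open>g\<close> must vanish; positive weights then force equality in each coordinate.\<close>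

lemma minimizer_on_group:
  assumes G: "partition_on {0..<n} G" and g: "g \<in> G"
    and Q: "\<And>s. s \<in> {1..t} \<Longrightarrow>
      Q s \<in> carrier_mat n n \<and> diagonal_mat (Q s) \<and> positive_semidefinite (Q s)"
    and b: "\<And>i. i < n \<Longrightarrow> 0 < curvature Q \<alpha> lam2 t i"
    and lam: "0 \<le> lam1" "0 \<le> lam21"
    and m: "\<And>s. s \<in> {1..t} \<Longrightarrow> m s \<in> carrier_vec n"
    and x: "\<And>s. s \<in> {1..t} \<Longrightarrow> x s \<in> carrier_vec n"
    and y: "is_arg_min (objective n G m Q \<alpha> lam1 lam21 lam2 x t) (\<lambda>y. y \<in> carrier_vec n) y"
    and i: "i \<in> g"
  shows "y $ i = group_minimizer (lam21 * sqrt (real (card g))) (curvature Q \<alpha> lam2 t)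
                   (\<lambda>i. soft lam1 (dual_sum n m Q \<alpha> x t $ i)) g i"
proof -
  let ?b = "curvature Q \<alpha> lam2 t" and ?z = "($) (dual_sum n m Q \<alpha> x t)"
  let ?F = "\<lambda>h. group_objective lam1 (lam21 * sqrt (real (card h))) ?b ?z h"
  define w where "w = group_minimizer (lam21 * sqrt (real (card g))) ?b (\<lambda>i. soft lam1 (?z i)) g"
  define v where "v = vec n (\<lambda>i. if i \<in> g then w i else y $ i)"
  have yc: "y \<in> carrier_vec n" and vc: "v \<in> carrier_vec n"
    using y by (auto simp: is_arg_min_def v_def)
  have sub: "h \<subseteq> {0..<n}" if "h \<in> G" for h
    using G that by (auto dest: partition_onD1)
  have fin: "finite g" "finite G"
    using sub[OF g] finite_elements[OF _ G] by (auto intro: finite_subset)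
  have bg: "0 < ?b j" if "j \<in> g" for j
    using b sub[OF g] that by auto
  have b0: "0 \<le> ?b j" if "j < n" for j
    using b[OF that] by simp
  have F_cong: "?F h p = ?F h q" if "\<And>j. j \<in> h \<Longrightarrow> p j = q j" for h p q
    using that by (simp add: group_objective_def weighted_norm_def)
  have "objective n G m Q \<alpha> lam1 lam21 lam2 x t y \<le> objective n G m Q \<alpha> lam1 lam21 lam2 x t v"
    using y vc by (simp add: is_arg_min_linorder)
  \<comment> \<open>The constant in \<open>objective_eq\<close> depends on the earlier iterates but
    not on the argument, so it cancels.\<close>
  then have "(\<Sum>h\<in>G. ?F h (($) y)) \<le> (\<Sum>h\<in>G. ?F h (($) v))"
    using objective_eq[where \<alpha> = \<alpha>, OF G Q b0 m x yc] objective_eq[where \<alpha> = \<alpha>, OF G Q b0 m x vc]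
    by simp
  moreover have "?F h (($) v) = ?F h (($) y)" if "h \<in> G - {g}" for h
  proof (rule F_cong)
    fix j assume "j \<in> h"
    moreover have "h \<inter> g = {}"
      using partition_onD2[OF G] g that by (auto simp: disjoint_def)
    ultimately have "j \<notin> g" "j < n"
      using sub[of h] that by auto
    then show "v $ j = y $ j"
      by (simp add: v_def)
  qed
  ultimately have "?F g (($) y) \<le> ?F g (($) v)"
    by (simp add: sum.remove[OF fin(2) g])
  also have "?F g (($) v) = ?F g w"
    using sub[OF g] by (intro F_cong) (auto simp: v_def)
  finally have "(\<Sum>j\<in>g. ?b j * (y $ j - w j)\<^sup>2) \<le> 0"
    using group_objective_gap[of g ?b "lam21 * sqrt (real (card g))" lam1 ?z "($) y"] bg lam
    by (simp add: w_def)
  moreover have nonneg: "0 \<le> ?b j * (y $ j - w j)\<^sup>2" if "j \<in> g" for j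
    using bg[OF that] by simp
  ultimately have "(\<Sum>j\<in>g. ?b j * (y $ j - w j)\<^sup>2) = 0"
    by (intro antisym sum_nonneg)
  then have "?b i * (y $ i - w i)\<^sup>2 = 0"
    using sum_nonneg_eq_0_iff[OF fin(1), of "\<lambda>j. ?b j * (y $ j - w j)\<^sup>2"] nonneg i by blast
  then show ?thesis
    using bg[OF i] by (simp add: w_def)
qed

theorem theorem1:
  fixes n T :: nat
    and x m :: "nat \<Rightarrow> real vec"
    and \<alpha> :: "nat \<Rightarrow> real"
    and Q :: "nat \<Rightarrow> real mat"
    and lam1 lam21 lam2 :: real
    and G :: "nat set set"
  assumes "T \<ge> 1"
    and "x 1 \<in> carrier_vec n"
    and "\<And>t. t \<in> {1..T} \<Longrightarrow> m t \<in> carrier_vec n"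
    and "\<And>t. t \<in> {1..T} \<Longrightarrow> \<alpha> t > 0"
    and "lam1 \<ge> 0" and "lam21 \<ge> 0" and "lam2 \<ge> 0"
    and "\<And>t. t \<in> {1..T} \<Longrightarrow>
           Q t \<in> carrier_mat n n \<and> diagonal_mat (Q t) \<and> positive_semidefinite (Q t)"
    and "\<And>t. t \<in> {1..T} \<Longrightarrow>
           diagonal_mat (scaled_sum n Q \<alpha> t) \<and> positive_definite (scaled_sum n Q \<alpha> t)"
    and "partition_on {0..<n} G"
    and "\<And>t. t \<in> {1..T} \<Longrightarrow>
           is_arg_min (objective n G m Q \<alpha> lam1 lam21 lam2 x t) (\<lambda>y. y \<in> carrier_vec n) (x (t + 1))"
  shows "\<forall>t \<in> {1..T}. \<forall>g \<in> G.
     (let s = soft_threshold lam1 (dual_sum n m Q \<alpha> x t);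
          s' = scaled_threshold n Q \<alpha> lam2 t s
      in subvec (x (t + 1)) g =
           mat_inv (scaled_sum (card g) (group_block Q g) \<alpha> t + (2 * lam2) \<cdot>\<^sub>m 1\<^sub>m (card g))
             *\<^sub>v (max (1 - sqrt (real (card g)) * lam21 / l2_norm (subvec s' g)) 0 \<cdot>\<^sub>v subvec s g))"
proof (intro ballI)
  fix t g assume t: "t \<in> {1..T}" and g: "g \<in> G"
  let ?b = "curvature Q \<alpha> lam2 t"
  let ?D = "\<lambda>i. (\<Sum>s = 1..t. Q s $$ (i, i) / \<alpha> s) + 2 * lam2"
  define s where "s = soft_threshold lam1 (dual_sum n m Q \<alpha> x t)"
  define s' where "s' = scaled_threshold n Q \<alpha> lam2 t s"
  have Q: "Q r \<in> carrier_mat n n \<and> diagonal_mat (Q r) \<and> positive_semidefinite (Q r)"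
    and m: "m r \<in> carrier_vec n" if "r \<in> {1..t}" for r
    using assms(3,8)[of r] t that by auto
  then have Q': "Q r \<in> carrier_mat n n \<and> diagonal_mat (Q r)" if "r \<in> {1..t}" for r
    using that by blast
  \<comment> \<open>The first iterate is given; iterate \<open>r > 1\<close> lies in the carrier
    because it is feasible for the problem at step \<open>r - 1\<close>.\<close>
  have x: "x r \<in> carrier_vec n" if "r \<in> {1..t}" for r
  proof (cases "r = 1")
    case False
    with that have r: "r = (r - 1) + 1" "r - 1 \<in> {1..T}"
      using t by auto
    have "x ((r - 1) + 1) \<in> carrier_vec n"
      using assms(11)[OF r(2)] by (simp add: is_arg_min_def)
    then show ?thesis
      using r(1) by metis
  qed (use assms(2) in simp)
  have D: "?D i = 2 * ?b i" for i
    by (simp add: curvature_def sum_distrib_left)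
  have b: "0 < ?b i" if "i < n" for i
  proof -
    \<comment> \<open>The zero multiple of the identity only brings the sum into the form of
      \<open>scaled_sum_eq_mat_diag\<close>.\<close>
    have "scaled_sum n Q \<alpha> t = scaled_sum n Q \<alpha> t + 0 \<cdot>\<^sub>m 1\<^sub>m n"
      by (intro eq_matI) (auto simp: scaled_sum_def)
    also have "\<dots> = mat_diag n (\<lambda>i. (\<Sum>s = 1..t. Q s $$ (i, i) / \<alpha> s) + 0)"
      using Q' by (rule scaled_sum_eq_mat_diag)
    finally have "positive_definite (mat_diag n (\<lambda>i. (\<Sum>s = 1..t. Q s $$ (i, i) / \<alpha> s) + 0))"
      using assms(9)[OF t] by metis
    from positive_definite_mat_diag_imp_pos[OF this that]
    show ?thesis
      using D[of i] assms(7) by simp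
  qed
  have gn: "g \<subseteq> {0..<n}"
    using assms(10) g by (auto dest: partition_onD1)
  have z: "dual_sum n m Q \<alpha> x t \<in> carrier_vec n"
    using dual_sum_eq[OF m Q' x] by simp
  then have s: "s = vec n (\<lambda>i. soft lam1 (dual_sum n m Q \<alpha> x t $ i))"
    by (auto simp: s_def soft_threshold_def soft_def)
  have s': "s' = vec n (\<lambda>i. s $ i / sqrt (?b i))"
  proof -
    have "scaled_sum n Q (\<lambda>r. 2 * \<alpha> r) t + lam2 \<cdot>\<^sub>m 1\<^sub>m n = mat_diag n ?b"
      unfolding curvature_def using Q' by (rule scaled_sum_eq_mat_diag)
    then have "mat_inv (mat_sqrt (scaled_sum n Q (\<lambda>r. 2 * \<alpha> r) t + lam2 \<cdot>\<^sub>m 1\<^sub>m n))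
      = mat_diag n (\<lambda>i. inverse (sqrt (?b i)))"
      using b by (simp add: mat_sqrt_mat_diag mat_inv_mat_diag less_imp_le less_imp_neq[symmetric])
    then show ?thesis
      by (simp add: s'_def scaled_threshold_def mat_diag_mult_vec s divide_inverse mult.commute)
  qed
  \<comment> \<open>If \<open>s\<close> vanishes on \<open>g\<close>, division by zero makes
    \<open>k\<close> equal to 1, and its product with \<open>subvec s g\<close> is still 0, as the
    convention for the closed form requires.\<close>
  define k where "k = max (1 - sqrt (real (card g)) * lam21 / l2_norm (subvec s' g)) 0"
  have k: "k = shrinkage (lam21 * sqrt (real (card g))) ?b g (\<lambda>i. soft lam1 (dual_sum n m Q \<alpha> x t $ i))"
  proof -
    have "(\<Sum>i\<in>g. (s' $ i)\<^sup>2) = (\<Sum>i\<in>g. (soft lam1 (dual_sum n m Q \<alpha> x t $ i) / sqrt (?b i))\<^sup>2)"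
      using gn by (intro sum.cong) (auto simp: s' s)
    then show ?thesis
      using l2_norm_subvec[of s' n g] gn by (simp add: k_def shrinkage_def s' mult.commute)
  qed
  have x': "x (t + 1) \<in> carrier_vec n"
    using assms(11)[OF t] by (simp add: is_arg_min_def)
  have pick: "pick g i \<in> g" "pick g i < n" if "i < card g" for i
    using pick_in_set_le[OF that] gn by auto
  \<comment> \<open>By \<open>D\<close> the diagonal entries are twice the curvature, hence positive
    and invertible.\<close>
  have "mat_inv (scaled_sum (card g) (group_block Q g) \<alpha> t + (2 * lam2) \<cdot>\<^sub>m 1\<^sub>m (card g))
      = mat_diag (card g) (\<lambda>i. inverse (2 * ?b (pick g i)))"
    by (subst scaled_sum_group_block[OF Q' gn], assumption, unfold D, rule mat_inv_mat_diag)
       (use b pick in \<open>simp add: less_imp_neq[symmetric]\<close>)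
  moreover have "subvec (x (t + 1)) g
      = mat_diag (card g) (\<lambda>i. inverse (2 * ?b (pick g i))) *\<^sub>v (k \<cdot>\<^sub>v subvec s g)"
  proof -
    have "x (t + 1) $ pick g i = inverse (2 * ?b (pick g i)) * (k * s $ pick g i)" if "i < card g" for i
      using minimizer_on_group[OF assms(10) g Q b assms(5,6) m x assms(11)[OF t] pick(1)[OF that]]
        pick(2)[OF that]
      by (simp add: group_minimizer_def s flip: k) (simp add: field_simps)
    moreover have "s \<in> carrier_vec n"
      by (simp add: s)
    ultimately show ?thesis
      using x' gn by (intro eq_vecI) (auto simp: subvec_eq mat_diag_mult_vec)
  qed
  ultimately show "let s = soft_threshold lam1 (dual_sum n m Q \<alpha> x t);
          s' = scaled_threshold n Q \<alpha> lam2 t s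
      in subvec (x (t + 1)) g =
           mat_inv (scaled_sum (card g) (group_block Q g) \<alpha> t + (2 * lam2) \<cdot>\<^sub>m 1\<^sub>m (card g))
             *\<^sub>v (max (1 - sqrt (real (card g)) * lam21 / l2_norm (subvec s' g)) 0 \<cdot>\<^sub>v subvec s g)"
    by (simp add: Let_def k_def s_def s'_def)
qed

end
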